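(* For every integer $n\ge 3$, $\gamma_I(C_3 \square C_n) = 2n$.
   Context: For an integer $k\ge 2$, $C_k$ denotes the directed cycle with vertex set $\{1,2,\dots,k\}$ and arcs $i\rightarrow i+1$ (indices taken modulo $k$). For digraphs $D_1=(V_1,A_1)$ and $D_2=(V_2,A_2)$, the cartesian product $D_1\square D_2$ is the digraph with vertex set $V_1\times V_2$ in which $(x_1,x_2)\rightarrow(y_1,y_2)$ is an arc if and only if either ($x_1=y_1$ and $x_2\rightarrow y_2$ in $D_2$) or ($x_1\rightarrow y_1$ in $D_1$ and $x_2=y_2$). An Italian dominating function on a digraph $D$ is a function $f:V(D)\to\{0,1,2\}$ such that every vertex $v$ with $f(v)=0$ has at least two in-neighbors $u$ with $f(u)=1$ or at least one in-neighbor $w$ with $f(w)=2$ (an in-neighbor of $v$ is a vertex $u$ with $u\rightarrow v$). Its weight is $\sum_{u\in V(D)} f(u)$, and the Italian domination number $\gamma_I(D)$ is the minimum weight of an Italian dominating function on $D$. *)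

theory Defs
  imports "Graph_Theory.Pair_Digraph"
begin

definition dicycle :: "nat \<Rightarrow> nat pair_pre_digraph" where
  "dicycle k = \<lparr> pverts = {1..k}, parcs = {(i, i mod k + 1) | i. i \<in> {1..k}} \<rparr>"

definition cartesian_product ::
  "'a pair_pre_digraph \<Rightarrow> 'b pair_pre_digraph \<Rightarrow> ('a \<times> 'b) pair_pre_digraph"
  (infixl \<open>\<box>\<close> 70) where
  "D1 \<box> D2 = \<lparr> pverts = pverts D1 \<times> pverts D2,
     parcs = {((x1, x2), (y1, y2)) | x1 x2 y1 y2.
       (x1, x2) \<in> pverts D1 \<times> pverts D2 \<and> (y1, y2) \<in> pverts D1 \<times> pverts D2 \<and>
       (x1 = y1 \<and> (x2, y2) \<in> parcs D2 \<or> (x1, y1) \<in> parcs D1 \<and> x2 = y2)} \<rparr>"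

definition in_neighbors :: "'a pair_pre_digraph \<Rightarrow> 'a \<Rightarrow> 'a set" where
  "in_neighbors D v = {u \<in> pverts D. (u, v) \<in> parcs D}"

text \<open>Only the values of \<open>f\<close> on the vertices of \<open>D\<close> matter; outside it is arbitrary.\<close>

definition italian_dominating_function :: "'a pair_pre_digraph \<Rightarrow> ('a \<Rightarrow> nat) \<Rightarrow> bool" where
  "italian_dominating_function D f \<longleftrightarrow>
     (\<forall>v \<in> pverts D. f v \<in> {0, 1, 2}) \<and>
     (\<forall>v \<in> pverts D. f v = 0 \<longrightarrow>
        (\<exists>u1 \<in> in_neighbors D v. \<exists>u2 \<in> in_neighbors D v. u1 \<noteq> u2 \<and> f u1 = 1 \<and> f u2 = 1) \<or>
        (\<exists>w \<in> in_neighbors D v. f w = 2))"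

definition weight :: "'a pair_pre_digraph \<Rightarrow> ('a \<Rightarrow> nat) \<Rightarrow> nat" where
  "weight D f = (\<Sum>u \<in> pverts D. f u)"

text \<open>Meant for finite digraphs; on an infinite vertex set the sum in \<open>weight\<close> degenerates to 0.\<close>

definition italian_domination_number :: "'a pair_pre_digraph \<Rightarrow> nat" (\<open>\<gamma>\<^sub>I\<close>) where
  "\<gamma>\<^sub>I D = (LEAST w. \<exists>f. italian_dominating_function D f \<and> weight D f = w)"

lemma pair_fin_digraph_dicycle: "pair_fin_digraph (dicycle k)"
proof
  show "finite (parcs (dicycle k))"
    by (simp add: dicycle_def setcompr_eq_image)
qed (auto simp: dicycle_def Suc_le_eq)

lemma pair_fin_digraph_cartesian_product:
  assumes "pair_fin_digraph D1" "pair_fin_digraph D2"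
  shows "pair_fin_digraph (D1 \<box> D2)"
proof
  show fin: "finite (pverts (D1 \<box> D2))"
    using assms by (simp add: cartesian_product_def pair_fin_digraph.pair_finite_verts)
  have "parcs (D1 \<box> D2) \<subseteq> pverts (D1 \<box> D2) \<times> pverts (D1 \<box> D2)"
    by (auto simp: cartesian_product_def)
  then show "finite (parcs (D1 \<box> D2))"
    using fin by (auto intro: finite_subset)
qed (auto simp: cartesian_product_def)

lemma italian_domination_number_attained:
  "\<exists>f. italian_dominating_function D f \<and> weight D f = \<gamma>\<^sub>I D"
proof -
  have "italian_dominating_function D (\<lambda>_. 1)"
    by (simp add: italian_dominating_function_def)
  then have "\<exists>w f. italian_dominating_function D f \<and> weight D f = w" by blast
  then show ?thesis unfolding italian_domination_number_def by (rule LeastI_ex)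
qed

lemma italian_domination_number_le:
  "italian_dominating_function D f \<Longrightarrow> \<gamma>\<^sub>I D \<le> weight D f"
  unfolding italian_domination_number_def by (rule Least_le) blast

end

theory Submission
  imports Defs
begin

text \<open>Write \<open>w j\<close> for the weight of the column \<open>C\<^sub>3 \<times> {j}\<close>. A column of weight 1 is preceded by one
  of weight at least 3, and a column of weight 0 by one of weight 6, so the deficit below 2 of each
  column is covered by the excess over 2 of its predecessor; summing around \<open>C\<^sub>n\<close> gives \<open>2 * n\<close> as a
  lower bound. Conversely, put one 0 and two 1s in each column, with the zeros of cyclically
  consecutive columns in different rows.\<close>

text \<open>The only in-neighbor of \<open>i\<close> in the directed cycle. The wrap-around is a
  case split, which avoids arithmetic with \<open>mod\<close>.\<close>

definition cycle_pred :: "nat \<Rightarrow> nat \<Rightarrow> nat" where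
  "cycle_pred k i = (if i = 1 then k else i - 1)"

lemma dicycle_arc_iff:
  assumes "i \<in> {1..k}"
  shows "(u, i) \<in> parcs (dicycle k) \<longleftrightarrow> u = cycle_pred k i"
proof
  assume "(u, i) \<in> parcs (dicycle k)"
  then have u: "1 \<le> u" "u \<le> k" "i = u mod k + 1"
    by (auto simp: dicycle_def)
  then show "u = cycle_pred k i"
    by (cases "u = k") (auto simp: cycle_pred_def)
next
  assume "u = cycle_pred k i"
  with assms show "(u, i) \<in> parcs (dicycle k)"
    by (auto simp: dicycle_def cycle_pred_def)
qed

lemma cycle_pred_mem: "i \<in> {1..k} \<Longrightarrow> cycle_pred k i \<in> {1..k}"
  by (auto simp: cycle_pred_def)

lemma cycle_pred_neq: "k \<ge> 2 \<Longrightarrow> i \<in> {1..k} \<Longrightarrow> cycle_pred k i \<noteq> i"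
  by (auto simp: cycle_pred_def)

text \<open>An injective self-map of a finite set is onto. This lets sums over predecessor columns
  be reindexed.\<close>

lemma bij_betw_cycle_pred: "bij_betw (cycle_pred k) {1..k} {1..k}"
proof -
  have "inj_on (cycle_pred k) {1..k}"
    by (auto simp: inj_on_def cycle_pred_def split: if_splits)
  moreover have "cycle_pred k ` {1..k} \<subseteq> {1..k}"
    using cycle_pred_mem by blast
  ultimately show ?thesis
    by (simp add: bij_betw_def endo_inj_surj)
qed

lemma pverts_dicycle_product: "pverts (dicycle m \<box> dicycle n) = {1..m} \<times> {1..n}"
  by (simp add: cartesian_product_def dicycle_def)

lemma in_neighbors_dicycle_product:
  assumes "i \<in> {1..m}" "j \<in> {1..n}"
  shows "in_neighbors (dicycle m \<box> dicycle n) (i, j) = {(cycle_pred m i, j), (i, cycle_pred n j)}"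
proof -
  have "pverts (dicycle k) = {1..k}" for k
    by (simp add: dicycle_def)
  then show ?thesis
    using assms cycle_pred_mem[OF assms(1)] cycle_pred_mem[OF assms(2)]
    by (auto simp: in_neighbors_def cartesian_product_def dicycle_arc_iff)
qed

text \<open>Every vertex has just two in-neighbors, distinct since \<open>m \<ge> 2\<close>
  separates their first coordinates. Two values at most 2 add up to at least 2 iff one of them is 2
  or both are 1.\<close>

lemma italian_dominating_function_dicycle_product_iff:
  assumes "m \<ge> 2"
  shows "italian_dominating_function (dicycle m \<box> dicycle n) f \<longleftrightarrow>
    (\<forall>i\<in>{1..m}. \<forall>j\<in>{1..n}. f (i, j) \<le> 2 \<and>
       (f (i, j) = 0 \<longrightarrow> 2 \<le> f (cycle_pred m i, j) + f (i, cycle_pred n j)))"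
proof -
  let ?D = "dicycle m \<box> dicycle n"
  have dom: "(\<exists>u1\<in>in_neighbors ?D (i, j). \<exists>u2\<in>in_neighbors ?D (i, j).
           u1 \<noteq> u2 \<and> f u1 = 1 \<and> f u2 = 1) \<or> (\<exists>w\<in>in_neighbors ?D (i, j). f w = 2)
         \<longleftrightarrow> 2 \<le> f (cycle_pred m i, j) + f (i, cycle_pred n j)"
    if bound: "\<forall>i\<in>{1..m}. \<forall>j\<in>{1..n}. f (i, j) \<le> 2" and ij: "i \<in> {1..m}" "j \<in> {1..n}" for i j
  proof -
    have "f (cycle_pred m i, j) \<le> 2" "f (i, cycle_pred n j) \<le> 2"
      using bound ij cycle_pred_mem by blast+
    then show ?thesis
      using cycle_pred_neq[OF assms ij(1)]
      by (auto simp: in_neighbors_dicycle_product[OF ij])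
  qed
  have "x \<in> {0, 1, 2} \<longleftrightarrow> x \<le> 2" for x :: nat
    by auto
  then have "italian_dominating_function ?D f \<longleftrightarrow>
      (\<forall>i\<in>{1..m}. \<forall>j\<in>{1..n}. f (i, j) \<le> 2) \<and>
      (\<forall>i\<in>{1..m}. \<forall>j\<in>{1..n}. f (i, j) = 0 \<longrightarrow>
        (\<exists>u1\<in>in_neighbors ?D (i, j). \<exists>u2\<in>in_neighbors ?D (i, j).
           u1 \<noteq> u2 \<and> f u1 = 1 \<and> f u2 = 1) \<or> (\<exists>w\<in>in_neighbors ?D (i, j). f w = 2))"
    by (simp only: italian_dominating_function_def pverts_dicycle_product ball_simps
        split_paired_Ball_Sigma)
  also have "\<dots> \<longleftrightarrow> (\<forall>i\<in>{1..m}. \<forall>j\<in>{1..n}. f (i, j) \<le> 2) \<and>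
      (\<forall>i\<in>{1..m}. \<forall>j\<in>{1..n}. f (i, j) = 0 \<longrightarrow>
         2 \<le> f (cycle_pred m i, j) + f (i, cycle_pred n j))"
    \<comment> \<open>\<open>conj_cong\<close> supplies the bound that \<open>dom\<close> requires:
      a value 3 would meet the inequality without dominating.\<close>
    by (rule conj_cong[OF refl], intro ball_cong refl) (simp only: dom)
  finally show ?thesis
    by (simp only: ball_conj_distrib)
qed

lemma weight_dicycle_product:
  "weight (dicycle m \<box> dicycle n) f = (\<Sum>j\<in>{1..n}. \<Sum>i\<in>{1..m}. f (i, j))"
  unfolding weight_def pverts_dicycle_product
  by (subst sum.swap) (simp add: sum.cartesian_product)

lemma sum_cycle3: "(\<Sum>i\<in>{1..3::nat}. g i) = g 1 + g 2 + (g 3 :: nat)"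
  by (simp add: numeral_3_eq_3 numeral_2_eq_2)

lemma italian_dominating_function_cycle3_weight_ge:
  assumes "italian_dominating_function (dicycle 3 \<box> dicycle n) f"
  shows "2 * n \<le> weight (dicycle 3 \<box> dicycle n) f"
proof -
  define w where "w j = (\<Sum>i\<in>{1..3}. f (i, j))" for j
  have deficit: "2 - w j \<le> w (cycle_pred n j) - 2" if "j \<in> {1..n}" for j
  proof -
    have dom: "f (i, j) = 0 \<Longrightarrow> 2 \<le> f (cycle_pred 3 i, j) + f (i, cycle_pred n j)"
      if "i \<in> {1..3}" for i
      using assms that \<open>j \<in> {1..n}\<close>
      by (simp add: italian_dominating_function_dicycle_product_iff)
    have pred3: "cycle_pred 3 1 = 3" "cycle_pred 3 2 = 1" "cycle_pred 3 3 = 2"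
      by (simp_all add: cycle_pred_def)
    have "f (1, j) = 0 \<Longrightarrow> 2 \<le> f (3, j) + f (1, cycle_pred n j)"
      "f (2, j) = 0 \<Longrightarrow> 2 \<le> f (1, j) + f (2, cycle_pred n j)"
      "f (3, j) = 0 \<Longrightarrow> 2 \<le> f (2, j) + f (3, cycle_pred n j)"
      using dom[of 1] dom[of 2] dom[of 3] unfolding pred3 by simp_all
    \<comment> \<open>If the column is 1 in one row and 0 elsewhere, the next row needs 1 and the
      row after it 2 from the preceding column, hence 3 in all. A zero column needs 2 in every
      row.\<close>
    then show ?thesis
      unfolding w_def sum_cycle3 by linarith
  qed
  have "(\<Sum>j\<in>{1..n}. 2 - w j) \<le> (\<Sum>j\<in>{1..n}. w (cycle_pred n j) - 2)"
    by (rule sum_mono) (rule deficit)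
  also have "\<dots> = (\<Sum>j\<in>{1..n}. w j - 2)"
    by (rule sum.reindex_bij_betw[OF bij_betw_cycle_pred])
  finally have le: "(\<Sum>j\<in>{1..n}. 2 - w j) \<le> (\<Sum>j\<in>{1..n}. w j - 2)" .
  \<comment> \<open>With truncated subtraction both summands equal
    \<open>max (w j) 2\<close>.\<close>
  have "(\<Sum>j\<in>{1..n}. w j + (2 - w j)) = (\<Sum>j\<in>{1..n}. 2 + (w j - 2))"
    by (rule sum.cong) auto
  then have "(\<Sum>j\<in>{1..n}. w j) + (\<Sum>j\<in>{1..n}. 2 - w j) = 2 * n + (\<Sum>j\<in>{1..n}. w j - 2)"
    by (simp only: sum.distrib) simp
  with le show ?thesis
    by (simp add: weight_dicycle_product w_def)
qed

lemma italian_dominating_function_cycle3_exists: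
  assumes "n \<ge> 2"
  shows "\<exists>f. italian_dominating_function (dicycle 3 \<box> dicycle n) f \<and>
    weight (dicycle 3 \<box> dicycle n) f = 2 * n"
proof -
  \<comment> \<open>The row of the zero in column \<open>j\<close>. Rows 1 and 2 alternate; the last
    column takes row 3 because for odd \<open>n\<close> the alternation would clash with column
    1.\<close>
  define z :: "nat \<Rightarrow> nat" where "z j = (if j = n then 3 else if even j then 2 else 1)" for j
  define f :: "nat \<times> nat \<Rightarrow> nat" where "f = (\<lambda>(i, j). if i = z j then 0 else 1)"
  have z_neq: "z (cycle_pred n j) \<noteq> z j" if "j \<in> {1..n}" for j
    using that assms by (auto simp: z_def cycle_pred_def)
  have two_le_three: "2 \<le> (3::nat)"
    by simp
  have "italian_dominating_function (dicycle 3 \<box> dicycle n) f"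
    unfolding italian_dominating_function_dicycle_product_iff[OF two_le_three]
  proof (intro ballI conjI impI)
    fix i j :: nat
    assume ij: "i \<in> {1..3}" "j \<in> {1..n}"
    show "f (i, j) \<le> 2"
      by (simp add: f_def)
    assume "f (i, j) = 0"
    then have "i = z j"
      by (simp add: f_def split: if_splits)
    \<comment> \<open>Both in-neighbors carry 1: column \<open>j\<close> has a single zero, and the
      zero of the preceding column lies in another row.\<close>
    then show "2 \<le> f (cycle_pred 3 i, j) + f (i, cycle_pred n j)"
      using z_neq[OF ij(2)] cycle_pred_neq[OF _ ij(1)] by (simp add: f_def)
  qed
  moreover have "(\<Sum>i\<in>{1..3}. f (i, j)) = 2" for j
    unfolding sum_cycle3 by (simp add: f_def z_def)
  then have "weight (dicycle 3 \<box> dicycle n) f = 2 * n"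
    by (simp add: weight_dicycle_product)
  ultimately show ?thesis
    by blast
qed

theorem theorem2p3:
  fixes n :: nat
  assumes "n \<ge> 3"
  shows "\<gamma>\<^sub>I (dicycle 3 \<box> dicycle n) = 2 * n"
proof (rule antisym)
  show "\<gamma>\<^sub>I (dicycle 3 \<box> dicycle n) \<le> 2 * n"
    using italian_dominating_function_cycle3_exists[of n] assms
      italian_domination_number_le[of "dicycle 3 \<box> dicycle n"] by force
  show "2 * n \<le> \<gamma>\<^sub>I (dicycle 3 \<box> dicycle n)"
    using italian_domination_number_attained[of "dicycle 3 \<box> dicycle n"]
      italian_dominating_function_cycle3_weight_ge by force
qed

end
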